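(* Let $I=\langle\mathcal A,v\rangle$ be a plain interpretation (for $\mathbf{P}$). For every set $\Gamma$ of infons there exists a closed set $M$ of $\mathcal A$ with $v(\Gamma)\subseteq M$ such that for every infon $\varphi$, if $\Gamma\not\vdash\varphi$ in $\mathbf{P}$ then $v(\varphi)\notin M$.
   Context: Infons: fix a set $At$ of atomic infons; infons are generated by $\varphi ::= \top \mid At \mid (\varphi\wedge\varphi)\mid(\varphi\to\varphi)$. Derivability in $\mathbf{P}$: $\Gamma\vdash\varphi$ iff there is a finite sequence $\varphi_1,\dots,\varphi_n=\varphi$ where each $\varphi_k$ is in $\Gamma\cup\{\top\}$ or follows from earlier members by one of the rules: from $\varphi_1,\varphi_2$ infer $\varphi_1\wedge\varphi_2$; from $\varphi_1\wedge\varphi_2$ infer $\varphi_i$ ($i=1,2$); from $\varphi_2$ infer $\varphi_1\to\varphi_2$; from $\varphi_1$ and $\varphi_1\to\varphi_2$ infer $\varphi_2$. A set $T$ of infons is deductively closed if $T\vdash\psi$ implies $\psi\in T$. Infon algebra: $\Sigma=\{0,1\}$; $\mathcal A=\langle\Sigma^*,\pi,l,r,\mathrm{enc},\mathrm{dec},E\rangle$ where $\pi,\mathrm{enc}:(\Sigma^* )^2\to\Sigma^*$ are total, $l,r,\mathrm{dec}$ are partial, with $l(\pi(x,y))=x$, $r(\pi(x,y))=y$, $\mathrm{dec}(x,\mathrm{enc}(x,y))=y$ defined and valid for all $x,y$, and $\emptyset\neq E\subseteq\Sigma^*$. A set $M\subseteq\Sigma^*$ is closed if $E\subseteq M$ and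 for all $a,b\in\Sigma^*$: (1) $a,b\in M\iff\pi(a,b)\in M$; (2) $a\in M$ and $\mathrm{enc}(a,b)\in M$ imply $b\in M$; (3) $b\in M$ implies $\mathrm{enc}(a,b)\in M$. An interpretation is $I=\langle\mathcal A,v\rangle$ with $v:At\cup\{\top\}\to\Sigma^*$ total, $v(\top)\in E$, extended by $v(\varphi_1\wedge\varphi_2)=\pi(v(\varphi_1),v(\varphi_2))$, $v(\varphi_1\to\varphi_2)=\mathrm{enc}(v(\varphi_1),v(\varphi_2))$, $v(\Gamma)=\{v(\psi):\psi\in\Gamma\}$. It is plain if it is injective ($v(\varphi_1)=v(\varphi_2)$ implies $\varphi_1=\varphi_2$ for infons) and conservative (for every deductively closed set $T$ of infons, the least closed set containing $v(T)$ contains no string $v(\psi)$ with $\psi\notin T$). *)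

theory Defs
  imports Main "HOL.Hull"
begin

datatype 'a infon =
    Top
  | Atom 'a
  | Conj "'a infon" "'a infon"  (infixr "\<and>\<^sub>i" 60)
  | Imp "'a infon" "'a infon"  (infixr "\<rightarrow>\<^sub>i" 55)

definition follows :: "'a infon set \<Rightarrow> 'a infon \<Rightarrow> bool" where
  "follows S \<phi> \<longleftrightarrow>
     (\<exists>\<phi>1 \<phi>2. \<phi>1 \<in> S \<and> \<phi>2 \<in> S \<and> \<phi> = (\<phi>1 \<and>\<^sub>i \<phi>2)) \<or>
     (\<exists>\<psi>. (\<phi> \<and>\<^sub>i \<psi>) \<in> S) \<or>
     (\<exists>\<psi>. (\<psi> \<and>\<^sub>i \<phi>) \<in> S) \<or>
     (\<exists>\<phi>1 \<phi>2. \<phi>2 \<in> S \<and> \<phi> = (\<phi>1 \<rightarrow>\<^sub>i \<phi>2)) \<or>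
     (\<exists>\<psi>. \<psi> \<in> S \<and> (\<psi> \<rightarrow>\<^sub>i \<phi>) \<in> S)"

definition derivation :: "'a infon set \<Rightarrow> 'a infon list \<Rightarrow> bool" where
  "derivation \<Gamma> \<phi>s \<longleftrightarrow>
     (\<forall>k < length \<phi>s. \<phi>s ! k \<in> \<Gamma> \<union> {Top} \<or> follows (set (take k \<phi>s)) (\<phi>s ! k))"

definition derivable :: "'a infon set \<Rightarrow> 'a infon \<Rightarrow> bool"  (infix "\<turnstile>" 50) where
  "\<Gamma> \<turnstile> \<phi> \<longleftrightarrow> (\<exists>\<phi>s. \<phi>s \<noteq> [] \<and> derivation \<Gamma> \<phi>s \<and> last \<phi>s = \<phi>)"

definition deductively_closed :: "'a infon set \<Rightarrow> bool" where
  "deductively_closed T \<longleftrightarrow> (\<forall>\<psi>. T \<turnstile> \<psi> \<longrightarrow> \<psi> \<in> T)"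

text \<open>Strings over the alphabet $\{0,1\}$ are Boolean lists; partial operations return options.\<close>

type_synonym bitstring = "bool list"

record algebra =
  pair_op :: "bitstring \<Rightarrow> bitstring \<Rightarrow> bitstring"
  left_op :: "bitstring \<Rightarrow> bitstring option"
  right_op :: "bitstring \<Rightarrow> bitstring option"
  enc_op :: "bitstring \<Rightarrow> bitstring \<Rightarrow> bitstring"
  dec_op :: "bitstring \<Rightarrow> bitstring \<Rightarrow> bitstring option"
  E_set :: "bitstring set"

definition infon_algebra :: "algebra \<Rightarrow> bool" where
  "infon_algebra A \<longleftrightarrow>
     (\<forall>x y. left_op A (pair_op A x y) = Some x) \<and>
     (\<forall>x y. right_op A (pair_op A x y) = Some y) \<and>
     (\<forall>x y. dec_op A x (enc_op A x y) = Some y) \<and>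
     E_set A \<noteq> {}"

definition closed_set :: "algebra \<Rightarrow> bitstring set \<Rightarrow> bool" where
  "closed_set A M \<longleftrightarrow>
     E_set A \<subseteq> M \<and>
     (\<forall>a b. (a \<in> M \<and> b \<in> M) \<longleftrightarrow> pair_op A a b \<in> M) \<and>
     (\<forall>a b. a \<in> M \<and> enc_op A a b \<in> M \<longrightarrow> b \<in> M) \<and>
     (\<forall>a b. b \<in> M \<longrightarrow> enc_op A a b \<in> M)"

text \<open>Closed sets are stable under intersection, so \<open>closed_set A hull X\<close> is the least closed set containing \<open>X\<close>.\<close>

lemma closed_set_hull: "closed_set A (closed_set A hull X)"
proof (rule hull_in)
  fix F
  assume "Ball F (closed_set A)"
  then have F: "closed_set A M" if "M \<in> F" for M
    using that by (rule bspec)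
  note F' = F [unfolded closed_set_def]
  have E: "E_set A \<subseteq> M" if "M \<in> F" for M
    by (rule F' [OF that, THEN conjunct1])
  have pair: "a \<in> M \<and> b \<in> M \<longleftrightarrow> pair_op A a b \<in> M" if "M \<in> F" for M a b
    by (rule F' [OF that, THEN conjunct2, THEN conjunct1, THEN spec, THEN spec])
  have enc_left: "b \<in> M" if "M \<in> F" "a \<in> M" "enc_op A a b \<in> M" for M a b
    by (rule F' [OF that(1), THEN conjunct2, THEN conjunct2, THEN conjunct1, THEN spec, THEN spec, THEN mp])
      (rule conjI, rule that(2), rule that(3))
  have enc: "enc_op A a b \<in> M" if "M \<in> F" "b \<in> M" for M a b
    by (rule F' [OF that(1), THEN conjunct2, THEN conjunct2, THEN conjunct2, THEN spec, THEN spec, THEN mp])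
      (rule that(2))
  show "closed_set A (\<Inter>F)"
    unfolding closed_set_def
  proof (intro conjI allI impI)
    show "E_set A \<subseteq> \<Inter>F"
      by (intro Inter_greatest E)
    show "a \<in> \<Inter>F \<and> b \<in> \<Inter>F \<longleftrightarrow> pair_op A a b \<in> \<Inter>F" for a b
      by (simp add: pair [symmetric] ball_conj_distrib)
    show "b \<in> \<Inter>F" if "a \<in> \<Inter>F \<and> enc_op A a b \<in> \<Inter>F" for a b
      using that enc_left by (metis Inter_iff)
    show "enc_op A a b \<in> \<Inter>F" if "b \<in> \<Inter>F" for a b
      using that enc by (metis Inter_iff)
  qed
qed

text \<open>The map \<open>v : At \<union> {\<top>} \<rightarrow> \<Sigma>\<^sup>*\<close> is given by its restriction
  to the atoms and its value at \<open>\<top>\<close>.\<close>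

record 'a interp =
  alg :: algebra
  v_atom :: "'a \<Rightarrow> bitstring"
  v_top :: bitstring

definition is_interpretation :: "'a interp \<Rightarrow> bool" where
  "is_interpretation I \<longleftrightarrow> infon_algebra (alg I) \<and> v_top I \<in> E_set (alg I)"

primrec val :: "'a interp \<Rightarrow> 'a infon \<Rightarrow> bitstring" where
  "val I Top = v_top I"
| "val I (Atom p) = v_atom I p"
| "val I (\<phi> \<and>\<^sub>i \<psi>) = pair_op (alg I) (val I \<phi>) (val I \<psi>)"
| "val I (\<phi> \<rightarrow>\<^sub>i \<psi>) = enc_op (alg I) (val I \<phi>) (val I \<psi>)"

definition conservative :: "'a interp \<Rightarrow> bool" where
  "conservative I \<longleftrightarrow>
     (\<forall>T. deductively_closed T \<longrightarrow>
        (\<forall>\<psi>. \<psi> \<notin> T \<longrightarrow> val I \<psi> \<notin> closed_set (alg I) hull (val I ` T)))"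

definition plain :: "'a interp \<Rightarrow> bool" where
  "plain I \<longleftrightarrow> inj (val I) \<and> conservative I"

end

theory Submission
  imports Defs
begin

text \<open>The deductive closure \<open>T\<close> of \<open>\<Gamma>\<close> is deductively closed, so by conservativity
  the least closed set containing \<open>v(T)\<close> contains no \<open>v(\<phi>)\<close> with \<open>\<phi>\<close> underivable
  from \<open>\<Gamma>\<close>.\<close>

lemma follows_mono: "follows S \<phi> \<Longrightarrow> S \<subseteq> S' \<Longrightarrow> follows S' \<phi>"
  unfolding follows_def by blast

lemma derivation_append:
  assumes "derivation \<Gamma> xs" and "derivation \<Gamma> ys"
  shows "derivation \<Gamma> (xs @ ys)"
  unfolding derivation_def
proof (intro allI impI)
  fix k
  assume k: "k < length (xs @ ys)"
  show "(xs @ ys) ! k \<in> \<Gamma> \<union> {Top} \<or> follows (set (take k (xs @ ys))) ((xs @ ys) ! k)"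
  proof (cases "k < length xs")
    case True
    then show ?thesis
      using assms(1) by (simp add: derivation_def nth_append)
  next
    case False
    with k have "ys ! (k - length xs) \<in> \<Gamma> \<union> {Top} \<or>
        follows (set (take (k - length xs) ys)) (ys ! (k - length xs))"
      using assms(2) by (simp add: derivation_def)
    \<comment> \<open>An entry of \<open>ys\<close> now has all of \<open>xs\<close> as additional
      predecessors. Rules look only at the set of earlier entries, so monotonicity of
      \<open>follows\<close> suffices.\<close>
    with False show ?thesis
      by (auto simp: nth_append intro: follows_mono)
  qed
qed

lemma derivation_snoc:
  assumes "derivation \<Gamma> xs" and "\<phi> \<in> \<Gamma> \<union> {Top} \<or> follows (set xs) \<phi>"
  shows "derivation \<Gamma> (xs @ [\<phi>])"
  using assms by (auto simp: derivation_def nth_append less_Suc_eq)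

lemma derivable_assumption: "\<phi> \<in> \<Gamma> \<union> {Top} \<Longrightarrow> \<Gamma> \<turnstile> \<phi>"
  unfolding derivable_def by (rule exI [of _ "[\<phi>]"]) (auto simp: derivation_def)

text \<open>A rule takes its premises from a single sequence, so separate derivations have to be
  merged. Concatenating them one by one does this; finiteness of \<open>S\<close> keeps the result a
  list.\<close>

lemma common_derivation:
  assumes "finite S" and "\<And>\<psi>. \<psi> \<in> S \<Longrightarrow> \<Gamma> \<turnstile> \<psi>"
  shows "\<exists>xs. derivation \<Gamma> xs \<and> S \<subseteq> set xs"
  using assms
proof (induction S)
  case empty
  then show ?case by (intro exI [of _ "[]"]) (simp add: derivation_def)
next
  case (insert \<psi> S)
  then obtain xs where "derivation \<Gamma> xs" "S \<subseteq> set xs" by blast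
  moreover obtain ys where "derivation \<Gamma> ys" "\<psi> \<in> set ys"
    using insert.prems [of \<psi>] unfolding derivable_def by (metis insertI1 last_in_set)
  ultimately have "derivation \<Gamma> (xs @ ys)" "insert \<psi> S \<subseteq> set (xs @ ys)"
    by (auto intro: derivation_append)
  then show ?case by blast
qed

text \<open>Derivability is preserved by every rule at once: with all of \<open>S\<close> in one
  derivation, \<open>\<phi>\<close> can be appended as its next entry. Stating this through
  \<open>follows\<close> avoids a case split over the rules.\<close>

lemma derivable_follows:
  assumes "finite S" and "\<And>\<psi>. \<psi> \<in> S \<Longrightarrow> \<Gamma> \<turnstile> \<psi>" and "follows S \<phi>"
  shows "\<Gamma> \<turnstile> \<phi>"
proof -
  obtain xs where "derivation \<Gamma> xs" "S \<subseteq> set xs"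
    using common_derivation [OF assms(1,2)] by blast
  then have "derivation \<Gamma> (xs @ [\<phi>])"
    using assms(3) by (blast intro: derivation_snoc follows_mono)
  then show ?thesis
    unfolding derivable_def by (intro exI [of _ "xs @ [\<phi>]"]) simp
qed

text \<open>This is a cut argument: strong induction along a derivation from the closure shows that
  each of its entries, not only the last, is derivable from \<Gamma>.\<close>

lemma deductively_closed_derivable: "deductively_closed {\<phi>. \<Gamma> \<turnstile> \<phi>}"
  unfolding deductively_closed_def
proof (intro allI impI)
  fix \<psi>
  assume "{\<phi>. \<Gamma> \<turnstile> \<phi>} \<turnstile> \<psi>"
  then obtain xs where xs: "xs \<noteq> []" "derivation {\<phi>. \<Gamma> \<turnstile> \<phi>} xs" "last xs = \<psi>"
    unfolding derivable_def by blast
  have "\<Gamma> \<turnstile> xs ! k" if "k < length xs" for k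
    using that
  proof (induction k rule: less_induct)
    case (less k)
    have "xs ! k \<in> {\<phi>. \<Gamma> \<turnstile> \<phi>} \<union> {Top} \<or> follows (set (take k xs)) (xs ! k)"
      using xs(2) less.prems by (simp add: derivation_def)
    then consider "\<Gamma> \<turnstile> xs ! k" | "xs ! k = Top" | "follows (set (take k xs)) (xs ! k)"
      by blast
    then show ?case
    proof cases
      case 2
      then show ?thesis by (simp add: derivable_assumption)
    next
      case 3
      \<comment> \<open>Here \<open>S\<close> is the set of entries before position
        \<open>k\<close>: finite, and derivable from \<Gamma> by the induction hypothesis.\<close>
      show ?thesis
        by (rule derivable_follows [OF _ _ 3]) (use less in \<open>auto simp: in_set_conv_nth\<close>)
    qed
  qed
  \<comment> \<open>As \<open>xs\<close> is nonempty, \<open>\<psi>\<close> is its entry at index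
    \<open>length xs - 1\<close>.\<close>
  with xs(1,3) show "\<psi> \<in> {\<phi>. \<Gamma> \<turnstile> \<phi>}"
    by (auto simp: last_conv_nth)
qed

theorem theorem2:
  fixes I :: "'a interp" and \<Gamma> :: "'a infon set"
  assumes "is_interpretation I" and "plain I"
  shows "\<exists>M. closed_set (alg I) M \<and> val I ` \<Gamma> \<subseteq> M \<and>
           (\<forall>\<phi>. \<not> \<Gamma> \<turnstile> \<phi> \<longrightarrow> val I \<phi> \<notin> M)"
proof (intro exI conjI)
  let ?T = "{\<phi>. \<Gamma> \<turnstile> \<phi>}"
  let ?M = "closed_set (alg I) hull (val I ` ?T)"
  show "closed_set (alg I) ?M" by (rule closed_set_hull)
  have "\<Gamma> \<subseteq> ?T" by (auto intro: derivable_assumption)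
  then show "val I ` \<Gamma> \<subseteq> ?M"
    using hull_subset [of "val I ` ?T" "closed_set (alg I)"] by blast
  show "\<forall>\<phi>. \<not> \<Gamma> \<turnstile> \<phi> \<longrightarrow> val I \<phi> \<notin> ?M"
    using assms(2) deductively_closed_derivable [of \<Gamma>]
    unfolding plain_def conservative_def by blast
qed

end
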